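(* Let $A\in M^+(n,\mathbb{R})$ with trace $\alpha$, and let $\varphi:\mathbb{R}^n\to\mathbb{R}$ be a continuous positive $A$-homogeneous function. Then: (1) the series $\zeta(\varphi,s)=\sum_{\omega\in\mathbb{Z}^n\setminus\{0\}}\varphi(\omega)^{-s}$ converges when $\operatorname{Re}s>\alpha$; (2) for real $\sigma$, $$\lim_{\sigma\to\alpha^+}(\sigma-\alpha)\,\zeta(\varphi,\sigma)=\alpha\,|B_\varphi|;$$ (3) for $r>0$, $$\lim_{r\to+\infty}\frac{\#\bigl(B_\varphi(r)\cap\mathbb{Z}^n\bigr)}{r^{\alpha}}=|B_\varphi|.$$
   Context: $n$ is a positive integer. $M^+(n,\mathbb{R})$ is the set of real $n\times n$ matrices all of whose eigenvalues $\lambda$ satisfy $\operatorname{Re}\lambda>0$. For $t>0$, $t^A:=e^{(\log t)A}$. A function $\varphi:\mathbb{R}^n\to\mathbb{R}$ is $A$-homogeneous if $\varphi(t^Ax)=t\varphi(x)$ for all $t>0$ and $x\in\mathbb{R}^n$ (so $\varphi(0)=0$). An $A$-homogeneous function with values in $[0,+\infty)$ is positive if $\varphi(x)>0$ for all $x\neq0$. For $r>0$, $B_\varphi(r)=\{x\in\mathbb{R}^n:\varphi(x)<r\}$ and $B_\varphi=B_\varphi(1)$. $|E|$ denotes the Lebesgue measure of $E\subset\mathbb{R}^n$ and $\#X$ the cardinality of a finite set $X$. *)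

theory Defs
  imports "HOL-Analysis.Analysis"
begin

definition complex_eigenvalue :: "real^'n^'n \<Rightarrow> complex \<Rightarrow> bool" where
  "complex_eigenvalue A \<mu> \<longleftrightarrow>
     (\<exists>v::complex^'n. v \<noteq> 0 \<and> map_matrix complex_of_real A *v v = \<mu> *s v)"

definition M_plus :: "(real^'n^'n) set" where
  "M_plus = {A. \<forall>\<mu>. complex_eigenvalue A \<mu> \<longrightarrow> Re \<mu> > 0}"

definition mat_pow :: "real^'n^'n \<Rightarrow> nat \<Rightarrow> real^'n^'n" where
  "mat_pow A k = (((**) A) ^^ k) (mat 1)"

text \<open>The library's \<^const>\<open>exp\<close> is not available here: multiplication on the type of
  matrices is componentwise, and the matrix type is not a normed algebra for \<open>(**)\<close>.\<close>

definition mat_exp :: "real^'n^'n \<Rightarrow> real^'n^'n" where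
  "mat_exp A = (\<Sum>k. (1 / fact k) *\<^sub>R mat_pow A k)"

definition real_powr_mat :: "real \<Rightarrow> real^'n^'n \<Rightarrow> real^'n^'n" where
  "real_powr_mat t A = mat_exp (ln t *\<^sub>R A)"

definition homogeneous_wrt :: "real^'n^'n \<Rightarrow> (real^'n \<Rightarrow> real) \<Rightarrow> bool" where
  "homogeneous_wrt A \<phi> \<longleftrightarrow> (\<forall>t>0. \<forall>x. \<phi> (real_powr_mat t A *v x) = t * \<phi> x)"

definition positive_homogeneous_wrt :: "real^'n^'n \<Rightarrow> (real^'n \<Rightarrow> real) \<Rightarrow> bool" where
  "positive_homogeneous_wrt A \<phi> \<longleftrightarrow>
     homogeneous_wrt A \<phi> \<and> (\<forall>x. \<phi> x \<ge> 0) \<and> (\<forall>x. x \<noteq> 0 \<longrightarrow> \<phi> x > 0)"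

definition sublevel :: "(real^'n \<Rightarrow> real) \<Rightarrow> real \<Rightarrow> (real^'n) set" where
  "sublevel \<phi> r = {x. \<phi> x < r}"

definition int_lattice :: "(real^'n) set" where
  "int_lattice = {x. \<forall>i. x $ i \<in> \<int>}"

definition zeta_term :: "(real^'n \<Rightarrow> real) \<Rightarrow> complex \<Rightarrow> real^'n \<Rightarrow> complex" where
  "zeta_term \<phi> s \<omega> = complex_of_real (\<phi> \<omega>) powr (- s)"

definition lattice_zeta :: "(real^'n \<Rightarrow> real) \<Rightarrow> complex \<Rightarrow> complex" where
  "lattice_zeta \<phi> s = (\<Sum>\<^sub>\<infinity>\<omega>\<in>int_lattice - {0}. zeta_term \<phi> s \<omega>)"

end

theory Submission
  imports Defs
begin

text \<open>
  Write \<open>B(r)\<close> for the sublevel sets of \<open>\<phi>\<close> and \<open>B = B(1)\<close>. Homogeneity says \<open>B(r) = r^A B\<close>, and by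
  Liouville's formula \<open>r^A\<close> has determinant \<open>r^\<alpha>\<close>, so \<open>B(r)\<close> has volume \<open>r^\<alpha> |B|\<close>.

  Everything rests on one fact, \<open>flow_contracts\<close>: the norm of \<open>r^(- A)\<close> tends to 0 as \<open>r\<close> grows. It can
  be read off from \<open>\<phi>\<close> itself. On the unit sphere \<open>\<phi>\<close> has a positive minimum, so
  \<open>r^A\<close> sends the sphere to points where \<open>\<phi>\<close> is large; as \<open>\<phi>\<close> is bounded on bounded sets, these
  points are far from the origin. Consequently \<open>B\<close> is bounded and \<open>\<alpha> > 0\<close>.

  To count, attach to each lattice point of \<open>B(r)\<close> its half-open unit cube and apply \<open>r^(- A)\<close> to the
  union. The result has volume \<open>r^(- \<alpha>)\<close> times the number of points. Its cells are small by the
  contraction, so by uniform continuity of \<open>\<phi>\<close> it lies between \<open>B(1 - \<eta>)\<close> and \<open>B(1 + \<eta>)\<close>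
  (\<open>rescaled_cells_sandwich\<close>), whose volumes are \<open>(1 - \<eta>)^\<alpha> |B|\<close> and \<open>(1 + \<eta>)^\<alpha> |B|\<close>. This
  is the counting limit.

  The statements on the zeta function use nothing but the count. By partial summation the series is \<open>\<sigma>\<close>
  times the integral of the counting function against \<open>u^(- \<sigma> - 1)\<close>; a counting function asymptotic to
  \<open>V u^\<alpha>\<close> gives convergence for \<open>\<sigma> > \<alpha>\<close> and a main term \<open>\<sigma> V / (\<sigma> - \<alpha>)\<close>
  (\<open>dirichlet_summable\<close>, \<open>dirichlet_residue\<close>).
\<close>

section \<open>The exponential of a real matrix\<close>

lemma mat_pow_Suc: "mat_pow A (Suc k) = A ** mat_pow A k"
  by (simp add: mat_pow_def)

lemma mat_pow_0: "mat_pow A 0 = mat 1"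
  by (simp add: mat_pow_def)

lemma mat_pow_commute: "A ** mat_pow A k = mat_pow A k ** A"
proof (induction k)
  case (Suc k)
  then show ?case by (metis mat_pow_Suc matrix_mul_assoc)
qed (simp add: mat_pow_0)

lemma mat_pow_scaleR: "mat_pow (s *\<^sub>R A) k = s ^ k *\<^sub>R mat_pow A k"
  by (induction k) (simp_all add: mat_pow_0 mat_pow_Suc matrix_scalar_ac flip: scalar_matrix_assoc)

lemma mat_pow_entry_bound:
  fixes A :: "real^'n^'n"
  shows "\<bar>mat_pow A k $ i $ j\<bar> \<le> (\<Sum>i\<in>UNIV. \<Sum>j\<in>UNIV. \<bar>A $ i $ j\<bar>) ^ k"
proof (induction k arbitrary: i j)
  case 0
  then show ?case by (simp add: mat_pow_0 mat_def)
next
  case (Suc k)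
  let ?C = "\<Sum>i\<in>UNIV. \<Sum>j\<in>UNIV. \<bar>A $ i $ j\<bar>"
  have "\<bar>mat_pow A (Suc k) $ i $ j\<bar> \<le> (\<Sum>l\<in>UNIV. \<bar>A $ i $ l * mat_pow A k $ l $ j\<bar>)"
    by (simp add: mat_pow_Suc matrix_matrix_mult_def)
  also have "\<dots> \<le> (\<Sum>l\<in>UNIV. \<bar>A $ i $ l\<bar> * ?C ^ k)"
    unfolding abs_mult by (intro sum_mono mult_left_mono Suc.IH) auto
  also have "\<dots> = (\<Sum>l\<in>UNIV. \<bar>A $ i $ l\<bar>) * ?C ^ k"
    by (simp add: sum_distrib_right)
  also have "\<dots> \<le> ?C * ?C ^ k"
    by (intro mult_right_mono member_le_sum[where f = "\<lambda>i. \<Sum>l\<in>UNIV. \<bar>A $ i $ l\<bar>"]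
        zero_le_power sum_nonneg) auto
  finally show ?case by simp
qed

lemma mat_exp_series_summable:
  fixes A :: "real^'n^'n"
  shows "summable (\<lambda>k. mat_pow A k $ i $ j / fact k * s ^ k)"
proof (rule summable_comparison_test'[where N = 0])
  let ?C = "\<Sum>i\<in>UNIV. \<Sum>j\<in>UNIV. \<bar>A $ i $ j\<bar>"
  show "summable (\<lambda>k. (?C * \<bar>s\<bar>) ^ k /\<^sub>R fact k)"
    by (rule summable_exp_generic)
  show "norm (mat_pow A k $ i $ j / fact k * s ^ k) \<le> (?C * \<bar>s\<bar>) ^ k /\<^sub>R fact k" for k
    using mult_right_mono[OF mat_pow_entry_bound[of A k i j], of "\<bar>s\<bar> ^ k / fact k"]
    by (simp add: abs_mult power_abs power_mult_distrib field_simps)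
qed

lemma sums_matrixI:
  fixes f :: "nat \<Rightarrow> real^'n^'m"
  assumes "\<And>i j. (\<lambda>k. f k $ i $ j) sums (S $ i $ j)"
  shows "f sums S"
  using assms unfolding sums_def by (intro vec_tendstoI) (simp add: sum_component)

lemma mat_exp_sums:
  fixes A :: "real^'n^'n"
  shows "(\<lambda>k. (1 / fact k) *\<^sub>R mat_pow A k) sums mat_exp A"
proof -
  have "(\<lambda>k. (1 / fact k) *\<^sub>R mat_pow A k) sums
      (\<chi> i j. \<Sum>k. mat_pow A k $ i $ j / fact k * 1 ^ k)"
    using mat_exp_series_summable[of A _ _ 1] by (intro sums_matrixI) (simp add: summable_sums)
  then show ?thesis
    by (simp add: mat_exp_def sums_iff)
qed

lemma mat_exp_entry_sums:
  fixes A :: "real^'n^'n"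
  shows "(\<lambda>k. mat_pow A k $ i $ j / fact k * s ^ k) sums (mat_exp (s *\<^sub>R A) $ i $ j)"
  using sums_vec_nth[OF sums_vec_nth[OF mat_exp_sums[of "s *\<^sub>R A"]], of i j]
  by (simp add: mat_pow_scaleR mult_ac)

lemma bilinear_matrix_mult:
  "bounded_bilinear ((**) :: real^'n^'m \<Rightarrow> real^'p^'n \<Rightarrow> real^'p^'m)"
  unfolding bilinear_conv_bounded_bilinear[symmetric] bilinear_def
  by (auto intro!: linearI simp: matrix_matrix_mult_def vec_eq_iff algebra_simps sum.distrib
      sum_distrib_left)

lemma mat_exp_commute:
  fixes A :: "real^'n^'n"
  shows "A ** mat_exp (s *\<^sub>R A) = mat_exp (s *\<^sub>R A) ** A"
proof -
  interpret m: bounded_bilinear "(**) :: real^'n^'n \<Rightarrow> real^'n^'n \<Rightarrow> real^'n^'n"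
    by (rule bilinear_matrix_mult)
  show ?thesis
    using m.bounded_linear_right[THEN bounded_linear.sums, OF mat_exp_sums[of "s *\<^sub>R A"], of A]
      m.bounded_linear_left[THEN bounded_linear.sums, OF mat_exp_sums[of "s *\<^sub>R A"], of A]
    by (simp add: sums_iff mat_pow_scaleR matrix_scalar_ac mat_pow_commute
        flip: scalar_matrix_assoc)
qed

lemma mat_exp_zero: "mat_exp (0 :: real^'n^'n) = mat 1"
proof -
  have "mat_exp (0 :: real^'n^'n) $ i $ j = mat 1 $ i $ j" for i j
    using sums_unique2[OF mat_exp_entry_sums[of "0 :: real^'n^'n" i j 0] powser_sums_zero]
    by (simp add: mat_pow_0)
  then show ?thesis by (simp add: vec_eq_iff)
qed

lemma has_vector_derivative_matrixI:
  fixes f :: "real \<Rightarrow> real^'n^'m"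
  assumes "\<And>i j. ((\<lambda>s. f s $ i $ j) has_real_derivative D $ i $ j) (at s)"
  shows "(f has_vector_derivative D) (at s)"
  unfolding has_vector_derivative_def
  by (subst has_derivative_componentwise_within)
    (use assms in \<open>auto simp: Basis_vec_def inner_axis has_field_derivative_def mult_commute_abs\<close>)

text \<open>Entry by entry, the exponential along a line is a real power series with infinite radius of
  convergence, so it can be differentiated term by term.\<close>

lemma mat_exp_has_vector_derivative:
  fixes A :: "real^'n^'n"
  shows "((\<lambda>s. mat_exp (s *\<^sub>R A)) has_vector_derivative A ** mat_exp (s *\<^sub>R A)) (at s)"
proof (rule has_vector_derivative_matrixI)
  fix i j :: 'n
  let ?c = "\<lambda>k. mat_pow A k $ i $ j / fact k"
  have eq: "(\<lambda>s. mat_exp (s *\<^sub>R A) $ i $ j) = (\<lambda>s. \<Sum>k. ?c k * s ^ k)"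
    using mat_exp_entry_sums[of A i j] by (simp add: sums_iff)
  have "(\<lambda>k. diffs ?c k * s ^ k) = (\<lambda>k. \<Sum>l\<in>UNIV. A $ i $ l * (mat_pow A k $ l $ j / fact k * s ^ k))"
    by (simp add: diffs_def mat_pow_Suc matrix_matrix_mult_def sum_divide_distrib sum_distrib_right
        fun_eq_iff field_simps sum_distrib_left del: of_nat_Suc)
  moreover have "\<dots> sums (\<Sum>l\<in>UNIV. A $ i $ l * mat_exp (s *\<^sub>R A) $ l $ j)"
    by (intro sums_sum sums_mult mat_exp_entry_sums)
  ultimately have "(\<Sum>k. diffs ?c k * s ^ k) = (A ** mat_exp (s *\<^sub>R A)) $ i $ j"
    by (simp add: sums_iff matrix_matrix_mult_def)
  then show "((\<lambda>s. mat_exp (s *\<^sub>R A) $ i $ j) has_real_derivative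
      (A ** mat_exp (s *\<^sub>R A)) $ i $ j) (at s)"
    unfolding eq using termdiffs_strong_converges_everywhere[OF mat_exp_series_summable, of A i j s]
    by simp
qed

text \<open>The left-hand side is constant in \<open>s\<close>, as its derivative is \<open>E(- s) A E(s + t) - A E(- s) E(s + t)\<close>
  and \<open>A\<close> commutes with its exponentials; at \<open>s = 0\<close> it is the right-hand side. This gives the group law
  without multiplying power series.\<close>

lemma mat_exp_shift:
  fixes A :: "real^'n^'n"
  shows "mat_exp ((- s) *\<^sub>R A) ** mat_exp ((s + t) *\<^sub>R A) = mat_exp (t *\<^sub>R A)"
proof -
  interpret m: bounded_bilinear "(**) :: real^'n^'n \<Rightarrow> real^'n^'n \<Rightarrow> real^'n^'n"
    by (rule bilinear_matrix_mult)
  let ?E = "\<lambda>s. mat_exp (s *\<^sub>R A)"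
  have "((\<lambda>s. ?E (- s) ** ?E (s + t)) has_vector_derivative 0) (at s)" for s
  proof -
    have "((\<lambda>s. ?E (- s)) has_vector_derivative (-1) *\<^sub>R (A ** ?E (- s))) (at s)"
      using vector_diff_chain_at[of uminus "-1" s ?E "A ** ?E (- s)"]
        mat_exp_has_vector_derivative[of A "- s"] DERIV_minus[OF DERIV_ident, of s UNIV]
      by (simp add: o_def has_real_derivative_iff_has_vector_derivative)
    moreover have "((\<lambda>s. ?E (s + t)) has_vector_derivative 1 *\<^sub>R (A ** ?E (s + t))) (at s)"
      using vector_diff_chain_at[of "\<lambda>s. s + t" 1 s ?E "A ** ?E (s + t)"]
        mat_exp_has_vector_derivative[of A "s + t"]
        DERIV_add[OF DERIV_ident DERIV_const[of t], of s UNIV]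
      by (simp add: o_def has_real_derivative_iff_has_vector_derivative)
    moreover have "A ** ?E (- s) ** ?E (s + t) = ?E (- s) ** (A ** ?E (s + t))"
      by (metis mat_exp_commute matrix_mul_assoc)
    ultimately show ?thesis
      using m.has_vector_derivative[of "\<lambda>s. ?E (- s)" _ s UNIV "\<lambda>s. ?E (s + t)"]
      by (force simp: m.minus_left)
  qed
  then obtain c where "?E (- s) ** ?E (s + t) = c" for s
    using has_derivative_zero_constant[of UNIV "\<lambda>s. ?E (- s) ** ?E (s + t)"]
    by (auto simp: has_vector_derivative_def)
  from this[of s] this[of 0] show ?thesis
    by (simp add: mat_exp_zero)
qed

lemma mat_exp_add:
  fixes A :: "real^'n^'n"
  shows "mat_exp ((s + t) *\<^sub>R A) = mat_exp (s *\<^sub>R A) ** mat_exp (t *\<^sub>R A)"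
proof -
  have "mat_exp (s *\<^sub>R A) ** mat_exp ((- s) *\<^sub>R A) = mat 1"
    using mat_exp_shift[of "- s" A 0] by (simp add: mat_exp_zero)
  then show ?thesis
    by (metis mat_exp_shift matrix_mul_assoc matrix_mul_lid)
qed

text \<open>Liouville's formula, from the derivative of the determinant at the identity, where it is the trace. In
  the Leibniz formula only the identity permutation contributes to that derivative: any other one moves
  at least two indices, and differentiating one factor of its product leaves a zero off-diagonal entry.\<close>

lemma det_one_parameter_group:
  fixes G :: "real \<Rightarrow> real^'m^'m" and D :: "real^'m^'m"
  assumes add: "\<And>s t. G (s + t) = G s ** G t" and zero: "G 0 = mat 1"
    and deriv: "\<And>i j. ((\<lambda>s. G s $ i $ j) has_real_derivative D $ i $ j) (at 0)"
  shows "det (G s) = exp (s * trace D)"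
proof -
  have d0: "((\<lambda>s. det (G s)) has_real_derivative trace D) (at 0)"
  proof -
    let ?P = "{p. p permutes (UNIV :: 'm set)}"
    let ?d = "\<lambda>p. of_int (sign p) * (\<Sum>i\<in>UNIV. D $ i $ p i * (\<Prod>j\<in>UNIV - {i}. G 0 $ j $ p j))"
    have "((\<lambda>s. det (G s)) has_real_derivative (\<Sum>p\<in>?P. ?d p)) (at 0)"
      unfolding det_def
      by (intro DERIV_sum DERIV_cmult has_field_derivative_prod deriv)
    moreover have "?d p = 0" if "p \<in> ?P - {id}" for p
    proof -
      have "(\<Prod>j\<in>UNIV - {i}. G 0 $ j $ p j) = 0" for i
      proof -
        have "\<exists>j. j \<noteq> i \<and> j \<noteq> p j"
        proof (rule ccontr)
          assume fixed: "\<not> ?thesis"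
          have "inj p" using that permutes_inj by blast
          then have "p i = i" by (metis fixed injD)
          then have "p = id" using fixed by (auto simp: fun_eq_iff)
          with \<open>p \<in> ?P - {id}\<close> show False by simp
        qed
        then show ?thesis
          by (intro prod_zero) (force simp: zero mat_def)+
      qed
      then show ?thesis by (simp del: prod_zero_iff)
    qed
    then have "(\<Sum>p\<in>?P. ?d p) = (\<Sum>p\<in>{id}. ?d p)"
      by (intro sum.mono_neutral_right) (auto simp: permutes_id finite_permutations)
    moreover have "\<dots> = trace D"
      by (simp add: zero mat_def trace_def)
    ultimately show ?thesis by simp
  qed
  \<comment> \<open>The group law carries the derivative from 0 to every other point.\<close>
  have "((\<lambda>s. det (G s) * exp (- (s * trace D))) has_real_derivative 0) (at s)" for s
  proof -
    have "((\<lambda>u. det (G s) * det (G (u - s))) has_real_derivative det (G s) * trace D) (at s)"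
      using d0 DERIV_shift[of "\<lambda>u. det (G u)" "trace D" s "- s"]
      by (intro DERIV_cmult) simp
    moreover have "det (G s) * det (G (u - s)) = det (G u)" for u
      using add[of s "u - s"] by (simp add: det_mul)
    ultimately show ?thesis
      by (auto intro!: derivative_eq_intros)
  qed
  then have "det (G s) * exp (- (s * trace D)) = det (G 0) * exp (- (0 * trace D))"
    using DERIV_isconst_all by blast
  then show ?thesis
    by (simp add: zero exp_minus field_simps)
qed

section \<open>Volume under a one-parameter group of matrices\<close>

text \<open>The volume formula \<open>measure_linear_image\<close> concerns well-ordered index types, whereas an index type here
  is only finite. A copy of the index type carries a well-order
  borrowed from the natural numbers, and renaming coordinates preserves Lebesgue measure.\<close>

typedef 'n ordered_copy = "UNIV :: 'n set" ..

instance ordered_copy :: (finite) finite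
proof
  have "(UNIV :: 'a ordered_copy set) = range Abs_ordered_copy"
    by (metis Abs_ordered_copy_cases UNIV_eq_I rangeI)
  then show "finite (UNIV :: 'a ordered_copy set)" by (metis finite finite_imageI)
qed

instantiation ordered_copy :: (finite) wellorder
begin

definition less_eq_ordered_copy :: "'a ordered_copy \<Rightarrow> 'a ordered_copy \<Rightarrow> bool" where
  "x \<le> y \<longleftrightarrow> to_nat (Rep_ordered_copy x) \<le> to_nat (Rep_ordered_copy y)"

definition less_ordered_copy :: "'a ordered_copy \<Rightarrow> 'a ordered_copy \<Rightarrow> bool" where
  "x < y \<longleftrightarrow> to_nat (Rep_ordered_copy x) < to_nat (Rep_ordered_copy y)"

instance
proof
  fix P :: "'a ordered_copy \<Rightarrow> bool" and a :: "'a ordered_copy"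
  assume step: "\<And>x. (\<And>y. y < x \<Longrightarrow> P y) \<Longrightarrow> P x"
  show "P a"
  proof (induction a rule: measure_induct_rule[where f = "\<lambda>x. to_nat (Rep_ordered_copy x)"])
    case (less x)
    show ?case by (rule step, rule less) (simp add: less_ordered_copy_def)
  qed
qed (auto simp: less_eq_ordered_copy_def less_ordered_copy_def Rep_ordered_copy_inject)

end

lemma bij_Abs_ordered_copy: "bij Abs_ordered_copy"
  by (metis Abs_ordered_copy_inverse Rep_ordered_copy_inverse UNIV_I bijI')

lemma bij_Rep_ordered_copy: "bij Rep_ordered_copy"
  by (metis Abs_ordered_copy_inverse Rep_ordered_copy_inverse UNIV_I bijI')

definition relabel :: "real^'n \<Rightarrow> real^'n ordered_copy" where
  "relabel x = (\<chi> i. x $ Rep_ordered_copy i)"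

definition unrelabel :: "real^'n ordered_copy \<Rightarrow> real^'n" where
  "unrelabel y = (\<chi> i. y $ Abs_ordered_copy i)"

lemma unrelabel_relabel [simp]: "unrelabel (relabel x) = x"
  by (simp add: relabel_def unrelabel_def vec_eq_iff Abs_ordered_copy_inverse)

lemma relabel_unrelabel [simp]: "relabel (unrelabel x) = x"
  by (simp add: relabel_def unrelabel_def vec_eq_iff Rep_ordered_copy_inverse)

lemma relabel_borel [measurable]: "relabel \<in> borel \<rightarrow>\<^sub>M borel"
  unfolding relabel_def by (intro borel_measurable_continuous_onI continuous_intros)

lemma unrelabel_borel [measurable]: "unrelabel \<in> borel \<rightarrow>\<^sub>M borel"
  unfolding unrelabel_def by (intro borel_measurable_continuous_onI continuous_intros)

lemma prod_Basis_vec: "(\<Prod>b\<in>Basis. (x :: real^'n) \<bullet> b) = (\<Prod>i\<in>UNIV. x $ i)"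
proof -
  have "(Basis :: (real^'n) set) = (\<lambda>i. axis i 1) ` UNIV"
    by (auto simp: Basis_vec_def)
  moreover have "inj (\<lambda>i. axis i (1::real) :: real^'n)"
    by (auto simp: inj_on_def axis_eq_axis)
  ultimately show ?thesis
    by (intro prod.reindex_cong[where l = "\<lambda>i. axis i 1"]) (simp_all add: inner_axis)
qed

lemma lborel_relabel: "lborel = distr lborel borel (relabel :: real^'n \<Rightarrow> _)"
proof (rule lborel_eqI)
  fix l u :: "real^'n ordered_copy"
  assume le: "\<And>b. b \<in> Basis \<Longrightarrow> l \<bullet> b \<le> u \<bullet> b"
  have "l $ i \<le> u $ i" for i
    using le[of "axis i 1"] by (simp add: inner_axis)
  then have le': "unrelabel l \<bullet> b \<le> unrelabel u \<bullet> b" if "b \<in> Basis" for b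
    using that by (auto simp: Basis_vec_def inner_axis unrelabel_def)
  have "relabel x \<in> box l u \<longleftrightarrow> x \<in> box (unrelabel l) (unrelabel u)" for x
    unfolding mem_box_cart relabel_def unrelabel_def
    by (simp, metis Abs_ordered_copy_inverse Rep_ordered_copy_inverse UNIV_I)
  then have "relabel -` box l u = box (unrelabel l) (unrelabel u)" by auto
  then have "emeasure (distr lborel borel relabel) (box l u)
      = (\<Prod>b\<in>Basis. (unrelabel u - unrelabel l) \<bullet> b)"
    using le' by (simp add: emeasure_distr emeasure_lborel_box)
  also have "\<dots> = (\<Prod>i\<in>UNIV. (u - l) $ Abs_ordered_copy i)"
    by (simp only: prod_Basis_vec) (simp add: unrelabel_def)
  also have "\<dots> = (\<Prod>i\<in>UNIV. (u - l) $ i)"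
    by (rule arg_cong[OF prod.reindex_bij_betw[OF bij_Abs_ordered_copy]])
  finally show "emeasure (distr lborel borel relabel) (box l u) = (\<Prod>b\<in>Basis. (u - l) \<bullet> b)"
    by (simp only: prod_Basis_vec)
qed simp

lemma relabel_image_borel:
  assumes "S \<in> sets borel"
  shows "relabel ` S \<in> sets borel"
proof -
  have "relabel ` S = unrelabel -` S"
    by (auto intro: image_eqI[where x = "unrelabel _"])
  then show ?thesis
    using measurable_sets[OF unrelabel_borel assms] by simp
qed

lemma emeasure_relabel_image:
  assumes "S \<in> sets borel"
  shows "emeasure lborel (relabel ` S) = emeasure lborel S"
proof -
  have "relabel -` relabel ` S = S"
    by (metis inj_on_def inj_vimage_image_eq unrelabel_relabel)
  then show ?thesis
    using relabel_image_borel[OF assms] by (subst lborel_relabel) (simp add: emeasure_distr)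
qed

text \<open>The determinant is computed for the renamed group, which is again a one-parameter group and whose
  generator has the same trace; in this way determinants over the two index types need not be compared.\<close>

lemma measure_one_parameter_group_image:
  fixes G :: "real \<Rightarrow> real^'n^'n" and D :: "real^'n^'n"
  assumes add: "\<And>s t. G (s + t) = G s ** G t" and zero: "G 0 = mat 1"
    and deriv: "\<And>i j. ((\<lambda>s. G s $ i $ j) has_real_derivative D $ i $ j) (at 0)"
    and S: "S \<in> sets borel" "S \<in> lmeasurable"
  shows "(*v) (G s) ` S \<in> lmeasurable"
    and "measure lebesgue ((*v) (G s) ` S) = exp (s * trace D) * measure lebesgue S"
proof -
  let ?R = "Rep_ordered_copy :: 'n ordered_copy \<Rightarrow> 'n"
  define H where "H s = (\<chi> i j. G s $ ?R i $ ?R j)" for s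
  have reindex: "(\<Sum>k\<in>UNIV. g (?R k)) = (\<Sum>k\<in>UNIV. g k)" for g :: "'n \<Rightarrow> real"
    by (rule sum.reindex_bij_betw[OF bij_Rep_ordered_copy])
  have "det (H s) = exp (s * trace (\<chi> i j. D $ ?R i $ ?R j))"
  proof (rule det_one_parameter_group)
    show "H (s + t) = H s ** H t" for s t
      by (simp add: H_def add matrix_matrix_mult_def vec_eq_iff
          reindex[of "\<lambda>k. G s $ _ $ k * G t $ k $ _"])
    show "H 0 = mat 1"
      by (simp add: H_def zero mat_def vec_eq_iff Rep_ordered_copy_inject)
  qed (simp add: H_def deriv)
  then have det: "det (H s) = exp (s * trace D)"
    by (simp add: trace_def reindex[of "\<lambda>k. D $ k $ k"])
  have G_inv: "G s *v (G (- s) *v x) = x" "G (- s) *v (G s *v x) = x" for x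
    by (metis add zero add.left_inverse add.right_inverse matrix_vector_mul_assoc
        matrix_vector_mul_lid)+
  have "(*v) (G s) ` S = (*v) (G (- s)) -` S \<inter> space borel"
    by (auto simp: G_inv intro: image_eqI[where x = "G (- s) *v _"])
  moreover have "(*v) (G (- s)) \<in> borel \<rightarrow>\<^sub>M borel"
    by (intro borel_measurable_continuous_onI matrix_vector_mult_linear_continuous_on)
  ultimately have GS: "(*v) (G s) ` S \<in> sets borel"
    by (metis measurable_sets S(1))
  have "relabel (G s *v x) = H s *v relabel x" for x
    by (simp add: relabel_def H_def matrix_vector_mult_def vec_eq_iff
        reindex[of "\<lambda>k. G s $ _ $ k * x $ k"])
  then have image: "relabel ` ((*v) (G s) ` S) = (*v) (H s) ` (relabel ` S)"
    by (simp add: image_image)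
  have "relabel ` S \<in> lmeasurable"
    using S relabel_image_borel[OF S(1)] by (simp add: fmeasurable_def emeasure_relabel_image)
  note linear_image = measurable_linear_image[OF _ this, of "(*v) (H s)"]
    measure_linear_image[OF _ this, of "(*v) (H s)"]
  show "(*v) (G s) ` S \<in> lmeasurable"
    using linear_image(1) GS emeasure_relabel_image[OF GS] relabel_image_borel[OF GS]
    by (simp add: fmeasurable_def flip: image)
  show "measure lebesgue ((*v) (G s) ` S) = exp (s * trace D) * measure lebesgue S"
    using linear_image(2) emeasure_relabel_image[OF GS] emeasure_relabel_image[OF S(1)]
      relabel_image_borel[OF GS] relabel_image_borel[OF S(1)] GS S(1)
    by (simp add: measure_def det flip: image)
qed

section \<open>Gauges adapted to a matrix\<close>

text \<open>Such a function \<open>\<phi>\<close> behaves like a norm whose dilations \<open>t^A\<close> scale different directions differently.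
  The dilations are written additively, as the flow \<open>s \<mapsto> e^(s A)\<close> with \<open>t = e^s\<close>.\<close>

locale anisotropic_gauge =
  fixes A :: "real^'n^'n" and \<phi> :: "real^'n \<Rightarrow> real"
  assumes cont: "continuous_on UNIV \<phi>" and hom: "positive_homogeneous_wrt A \<phi>"
begin

definition flow :: "real \<Rightarrow> real^'n \<Rightarrow> real^'n" where
  "flow s x = mat_exp (s *\<^sub>R A) *v x"

lemma flow_eq_matrix: "flow s = (*v) (mat_exp (s *\<^sub>R A))"
  by (simp add: flow_def fun_eq_iff)

lemma bounded_linear_flow: "bounded_linear (flow s)"
  by (simp add: flow_eq_matrix)

lemma flow_zero_time: "flow 0 x = x"
  by (simp add: flow_def mat_exp_zero)

lemma flow_flow: "flow s (flow t x) = flow (s + t) x"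
  by (simp add: flow_def mat_exp_add matrix_vector_mul_assoc)

lemma flow_inverse: "flow s (flow (- s) x) = x" "flow (- s) (flow s x) = x"
  by (simp_all add: flow_flow flow_zero_time)

lemma gauge_flow: "\<phi> (flow s x) = exp s * \<phi> x"
proof -
  have "\<forall>t>0. \<forall>x. \<phi> (real_powr_mat t A *v x) = t * \<phi> x"
    using hom by (simp add: positive_homogeneous_wrt_def homogeneous_wrt_def)
  from this[rule_format, of "exp s" x] show ?thesis
    by (simp add: real_powr_mat_def flow_def)
qed

lemma gauge_nonneg: "\<phi> x \<ge> 0"
  using hom by (simp add: positive_homogeneous_wrt_def)

lemma gauge_pos: "x \<noteq> 0 \<Longrightarrow> \<phi> x > 0"
  using hom by (simp add: positive_homogeneous_wrt_def)

lemma gauge_zero: "\<phi> 0 = 0"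
  using gauge_flow[of 1 0] linear_simps(3)[OF bounded_linear_flow] by simp

lemma gauge_sphere_lower_bound:
  obtains m where "m > 0" "\<And>x. norm x = 1 \<Longrightarrow> m \<le> \<phi> x"
proof -
  obtain e :: "real^'n" where "norm e = 1" using vector_choose_size[of 1] by auto
  then have "sphere (0 :: real^'n) 1 \<noteq> {}" by auto
  then obtain z where z: "z \<in> sphere 0 1" "\<And>x. x \<in> sphere 0 1 \<Longrightarrow> \<phi> z \<le> \<phi> x"
    using continuous_attains_inf[of "sphere 0 1" \<phi>] continuous_on_subset[OF cont] by auto
  have "z \<noteq> 0" using z(1) by auto
  then show ?thesis using z that[of "\<phi> z"] gauge_pos by simp
qed

text \<open>The dilations contract uniformly as \<open>t\<close> tends to 0. The function \<open>\<phi>\<close> is bounded below by some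
  \<open>m > 0\<close> on the unit sphere, so after time \<open>s\<close> its values on the image of the sphere are at least
  \<open>e^s m\<close>. Once this exceeds the maximum of \<open>\<phi>\<close> on the ball of radius \<open>1 / \<epsilon>\<close>, the sphere has left
  that ball, and by linearity the inverse map shrinks every vector by the factor \<open>\<epsilon>\<close>.\<close>

lemma flow_contracts:
  assumes "\<epsilon> > 0"
  obtains s\<^sub>0 where "\<And>s x. s \<ge> s\<^sub>0 \<Longrightarrow> norm (flow (- s) x) \<le> \<epsilon> * norm x"
proof -
  obtain m where m: "m > 0" "\<And>x. norm x = 1 \<Longrightarrow> m \<le> \<phi> x"
    using gauge_sphere_lower_bound by blast
  have "bdd_above (\<phi> ` cball 0 (1 / \<epsilon>))"
    using compact_continuous_image[OF continuous_on_subset[OF cont] compact_cball]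
    by (intro bounded_imp_bdd_above compact_imp_bounded) auto
  then obtain M where "\<forall>y \<in> \<phi> ` cball 0 (1 / \<epsilon>). y \<le> M"
    unfolding bdd_above_def by blast
  then have M: "\<phi> x \<le> M" if "norm x \<le> 1 / \<epsilon>" for x
    using that by simp
  define s\<^sub>0 where "s\<^sub>0 = ln ((\<bar>M\<bar> + 1) / m)"
  have expands: "1 / \<epsilon> < norm (flow s x)" if "s \<ge> s\<^sub>0" "norm x = 1" for s x
  proof (rule ccontr)
    assume "\<not> ?thesis"
    then have "exp s * \<phi> x \<le> M" using M[of "flow s x"] by (simp add: gauge_flow)
    moreover have "\<bar>M\<bar> + 1 = exp s\<^sub>0 * m"
      using m(1) by (simp add: s\<^sub>0_def add_nonneg_pos)
    moreover have "\<dots> \<le> exp s * \<phi> x"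
      using that m by (intro mult_mono) auto
    ultimately show False by linarith
  qed
  show ?thesis
  proof (rule that)
    fix s x assume s: "s\<^sub>0 \<le> s"
    define y where "y = flow (- s) x"
    show "norm (flow (- s) x) \<le> \<epsilon> * norm x"
    proof (cases "y = 0")
      case False
      have "1 / \<epsilon> < norm (flow s ((1 / norm y) *\<^sub>R y))"
        using False s by (intro expands) auto
      also have "\<dots> = norm x / norm y"
        by (simp add: y_def linear_simps(5)[OF bounded_linear_flow] flow_inverse)
      finally show ?thesis
        using False assms by (simp add: field_simps flip: y_def)
    qed (use assms in \<open>simp add: y_def\<close>)
  qed
qed

lemma continuous_on_flow: "continuous_on S (\<lambda>s. flow (- s) x)"
proof -
  have "continuous_on UNIV (\<lambda>s. mat_exp (s *\<^sub>R A))"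
    using has_vector_derivative_continuous[OF mat_exp_has_vector_derivative]
    by (blast intro: continuous_at_imp_continuous_on)
  then have "continuous_on S (\<lambda>s. mat_exp ((- s) *\<^sub>R A))"
    by (rule continuous_on_compose2) (auto intro: continuous_intros)
  then show ?thesis
    unfolding flow_def matrix_vector_mult_def by (intro continuous_intros)
qed

lemma sublevel_flow: "sublevel \<phi> (exp s * r) = flow s ` sublevel \<phi> r"
proof (intro equalityI subsetI)
  fix x assume "x \<in> sublevel \<phi> (exp s * r)"
  then have "\<phi> (flow (- s) x) < r"
    by (simp add: sublevel_def gauge_flow exp_minus field_simps)
  then show "x \<in> flow s ` sublevel \<phi> r"
    by (intro image_eqI[where x = "flow (- s) x"]) (simp_all add: flow_inverse sublevel_def)
next
  fix x assume "x \<in> flow s ` sublevel \<phi> r"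
  then show "x \<in> sublevel \<phi> (exp s * r)"
    by (auto simp: sublevel_def gauge_flow)
qed

text \<open>A point outside the unit ball is contracted to the origin, so its backward orbit crosses the unit
  sphere. As \<open>\<phi>\<close> decreases along that orbit, its value at the point is at least the minimum \<open>m\<close> of
  \<open>\<phi>\<close> on the sphere; hence the sublevel set of \<open>m\<close> lies in the unit ball. Any other nonempty sublevel set
  is the image of that one under a linear map.\<close>

lemma bounded_sublevel: "bounded (sublevel \<phi> r)"
proof (cases "r > 0")
  case True
  obtain m where m: "m > 0" "\<And>x. norm x = 1 \<Longrightarrow> m \<le> \<phi> x"
    using gauge_sphere_lower_bound by blast
  have "norm x < 1" if "\<phi> x < m" for x
  proof (rule ccontr)
    assume "\<not> norm x < 1"
    then have x: "norm x \<ge> 1" by simp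
    then have "1 / norm x > 0" by (intro divide_pos_pos) linarith+
    from flow_contracts[OF this] obtain s\<^sub>0
      where s\<^sub>0: "\<And>s y. s \<ge> s\<^sub>0 \<Longrightarrow> norm (flow (- s) y) \<le> (1 / norm x) * norm y"
      by blast
    have "norm (flow (- max s\<^sub>0 0) x) \<le> (1 / norm x) * norm x" by (rule s\<^sub>0) simp
    also have "\<dots> \<le> 1" by simp
    finally have "\<exists>s\<ge>0. s \<le> max s\<^sub>0 0 \<and> norm (flow (- s) x) = 1"
      using x by (intro IVT2' continuous_on_norm continuous_on_flow) (simp_all add: flow_zero_time)
    then obtain s where s: "s \<ge> 0" "norm (flow (- s) x) = 1" by blast
    have "m \<le> exp (- s) * \<phi> x" using m(2)[OF s(2)] by (simp add: gauge_flow)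
    also have "\<dots> \<le> \<phi> x" using s(1) gauge_nonneg[of x] by (simp add: mult_left_le_one_le)
    finally show False using that by simp
  qed
  then have "sublevel \<phi> m \<subseteq> cball 0 1"
    by (auto simp: sublevel_def less_imp_le)
  then have "bounded (flow (ln (r / m)) ` sublevel \<phi> m)"
    by (intro bounded_linear_image bounded_linear_flow)
      (metis bounded_cball bounded_subset)
  moreover have "exp (ln (r / m)) * m = r" using True m by simp
  ultimately show ?thesis using sublevel_flow by metis
next
  case False
  then have "sublevel \<phi> r = {}"
    unfolding sublevel_def using gauge_nonneg by (smt (verit) empty_Collect_eq)
  then show ?thesis by simp
qed

lemma open_sublevel: "open (sublevel \<phi> r)"
  unfolding sublevel_def using cont by (intro open_Collect_less continuous_intros)

lemma lmeasurable_sublevel: "sublevel \<phi> r \<in> lmeasurable"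
  by (simp add: bounded_sublevel open_sublevel lmeasurable_open)

lemma flow_image_measure:
  assumes "S \<in> sets borel" "S \<in> lmeasurable"
  shows "flow s ` S \<in> lmeasurable"
    and "measure lebesgue (flow s ` S) = exp (s * trace A) * measure lebesgue S"
proof -
  have deriv: "((\<lambda>s. mat_exp (s *\<^sub>R A) $ i $ j) has_real_derivative A $ i $ j) (at 0)" for i j
    using mat_exp_has_vector_derivative[of A 0, THEN
        bounded_linear.has_vector_derivative[OF bounded_linear_compose[OF bounded_linear_vec_nth
            bounded_linear_vec_nth]], of i j]
    by (simp add: mat_exp_zero has_real_derivative_iff_has_vector_derivative)
  show "flow s ` S \<in> lmeasurable"
    "measure lebesgue (flow s ` S) = exp (s * trace A) * measure lebesgue S"
    using measure_one_parameter_group_image[of "\<lambda>s. mat_exp (s *\<^sub>R A)", OF mat_exp_add _ deriv assms]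
    by (simp_all add: mat_exp_zero flow_eq_matrix)
qed

lemma measure_sublevel:
  assumes "r > 0"
  shows "measure lebesgue (sublevel \<phi> r) = r powr trace A * measure lebesgue (sublevel \<phi> 1)"
proof -
  have "sublevel \<phi> r = flow (ln r) ` sublevel \<phi> 1"
    using sublevel_flow[of "ln r" 1] assms by simp
  also have "measure lebesgue \<dots> = exp (ln r * trace A) * measure lebesgue (sublevel \<phi> 1)"
    by (intro flow_image_measure lmeasurable_sublevel borel_open open_sublevel)
  finally show ?thesis
    using assms by (simp add: powr_def mult.commute)
qed

text \<open>The sublevel sets exhaust the space, so their volumes \<open>r^\<alpha> |B|\<close> are unbounded as \<open>r\<close> grows,
  which forces \<open>\<alpha> > 0\<close>. A cube
  with volume larger than \<open>|B|\<close>, which by compactness lies in some sublevel set, makes this explicit.\<close>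

lemma trace_pos: "trace A > 0"
proof (rule ccontr)
  assume neg: "\<not> trace A > 0"
  define c where "c = 1 + measure lebesgue (sublevel \<phi> 1)"
  have c: "c \<ge> 1" by (simp add: c_def)
  define Q :: "(real^'n) set" where "Q = cbox 0 (\<chi> i. c)"
  have "c = c ^ 1" by simp
  also have "\<dots> \<le> c ^ CARD('n)" using c by (intro power_increasing) auto
  also have "\<dots> = measure lebesgue Q"
    using c by (simp add: Q_def content_cbox_cart interval_ne_empty_cart)
  finally have big: "c \<le> measure lebesgue Q" .
  have "bdd_above (\<phi> ` Q)"
    using compact_continuous_image[OF continuous_on_subset[OF cont]] unfolding Q_def
    by (intro bounded_imp_bdd_above compact_imp_bounded) auto
  then obtain M where M: "\<And>x. x \<in> Q \<Longrightarrow> \<phi> x \<le> M"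
    by (auto simp: bdd_above_def)
  define r where "r = \<bar>M\<bar> + 1"
  have "Q \<subseteq> sublevel \<phi> r"
    using M by (force simp: sublevel_def r_def)
  then have "measure lebesgue Q \<le> measure lebesgue (sublevel \<phi> r)"
    by (intro measure_mono_fmeasurable lmeasurable_sublevel) (simp_all add: Q_def)
  also have "\<dots> = r powr trace A * measure lebesgue (sublevel \<phi> 1)"
    by (intro measure_sublevel) (simp add: r_def)
  also have "\<dots> \<le> r powr 0 * measure lebesgue (sublevel \<phi> 1)"
    using neg by (intro mult_right_mono powr_mono) (auto simp: r_def)
  also have "\<dots> = measure lebesgue (sublevel \<phi> 1)" by (simp add: r_def)
  also have "\<dots> < c" by (simp add: c_def)
  finally show False using big by simp
qed

end

section \<open>Counting lattice points\<close>

definition lattice_floor :: "real^'n \<Rightarrow> real^'n" where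
  "lattice_floor x = (\<chi> i. of_int \<lfloor>x $ i\<rfloor>)"

lemma lattice_floor_in_lattice: "lattice_floor x \<in> int_lattice"
  by (simp add: lattice_floor_def int_lattice_def)

lemma norm_lattice_floor_diff: "norm (lattice_floor x - x) \<le> real CARD('n)" for x :: "real^'n"
proof -
  have "norm (lattice_floor x - x) \<le> (\<Sum>i\<in>UNIV. \<bar>(lattice_floor x - x) $ i\<bar>)"
    by (rule norm_le_l1_cart)
  also have "\<dots> \<le> (\<Sum>i\<in>(UNIV :: 'n set). 1)"
  proof (rule sum_mono)
    fix i
    show "\<bar>(lattice_floor x - x) $ i\<bar> \<le> 1"
      using floor_correct[of "x $ i"] by (simp add: lattice_floor_def abs_le_iff) linarith
  qed
  finally show ?thesis by simp
qed

lemma finite_bounded_lattice: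
  fixes S :: "(real^'n) set"
  assumes "bounded S"
  shows "finite (S \<inter> int_lattice)"
proof -
  obtain K where K: "\<And>x. x \<in> S \<Longrightarrow> norm x \<le> K"
    using assms by (auto simp: bounded_iff)
  let ?F = "(UNIV :: 'n set) \<rightarrow>\<^sub>E {- \<lceil>K\<rceil>..\<lceil>K\<rceil>}"
  have "S \<inter> int_lattice \<subseteq> (\<lambda>f. \<chi> i. of_int (f i)) ` ?F"
  proof
    fix x assume x: "x \<in> S \<inter> int_lattice"
    have "x = (\<chi> i. of_int \<lfloor>x $ i\<rfloor>)"
      using x by (simp add: int_lattice_def vec_eq_iff)
    moreover have "\<lfloor>x $ i\<rfloor> \<in> {- \<lceil>K\<rceil>..\<lceil>K\<rceil>}" for i
    proof -
      have "\<bar>x $ i\<bar> \<le> K" using K[of x] x component_le_norm_cart[of x i] by simp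
      moreover have "x $ i = of_int \<lfloor>x $ i\<rfloor>" using x by (simp add: int_lattice_def)
      ultimately show ?thesis by simp linarith
    qed
    ultimately show "x \<in> (\<lambda>f. \<chi> i. of_int (f i)) ` ?F"
      by (intro image_eqI[where x = "\<lambda>i. \<lfloor>x $ i\<rfloor>"]) auto
  qed
  then show ?thesis
    by (rule finite_subset) (intro finite_imageI finite_PiE, auto)
qed

text \<open>The half-open unit cube at a lattice point differs from the closed one only in the boundary, which is
  negligible.\<close>

lemma lattice_cell:
  fixes \<omega> :: "real^'n"
  assumes "\<omega> \<in> int_lattice"
  shows "{x. lattice_floor x = \<omega>} \<in> sets borel"
    and "{x. lattice_floor x = \<omega>} \<in> lmeasurable"
    and "measure lebesgue {x. lattice_floor x = \<omega>} = 1"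
proof -
  have "real_of_int \<lfloor>x $ i\<rfloor> = \<omega> $ i \<longleftrightarrow> \<omega> $ i \<le> x $ i \<and> x $ i < \<omega> $ i + 1" for x i
  proof -
    obtain k :: int where "\<omega> $ i = of_int k"
      using assms Ints_cases by (auto simp: int_lattice_def)
    then show ?thesis by (simp add: floor_eq_iff)
  qed
  then have cell: "{x. lattice_floor x = \<omega>} = (\<Inter>i. {x. \<omega> $ i \<le> x $ i} \<inter> {x. x $ i < \<omega> $ i + 1})"
    by (auto simp: lattice_floor_def vec_eq_iff)
  also have "\<dots> \<in> sets borel"
    by (intro sets.finite_INT sets.Int borel_closed borel_open
        closed_halfspace_component_ge_cart open_halfspace_component_lt_cart) auto
  finally show "{x. lattice_floor x = \<omega>} \<in> sets borel" .
  have neg: "negligible (cbox \<omega> (\<chi> i. \<omega> $ i + 1) - {x. lattice_floor x = \<omega>} \<union>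
      ({x. lattice_floor x = \<omega>} - cbox \<omega> (\<chi> i. \<omega> $ i + 1)))"
    by (rule negligible_subset[OF negligible_frontier_interval[of \<omega> "\<chi> i. \<omega> $ i + 1"]])
      (auto simp: cell mem_box_cart less_imp_le)
  show "{x. lattice_floor x = \<omega>} \<in> lmeasurable"
    using lmeasurable_negligible_symdiff[OF _ neg] by simp
  show "measure lebesgue {x. lattice_floor x = \<omega>} = 1"
    using measure_negligible_symdiff[OF _ neg]
    by (simp add: content_cbox_cart interval_ne_empty_cart)
qed

text \<open>This turns counting into measuring: the cells of a finite set of lattice points are disjoint and have
  volume 1 each.\<close>

lemma lattice_cells:
  fixes L :: "(real^'n) set"
  assumes "finite L" "L \<subseteq> int_lattice"
  shows "{x. lattice_floor x \<in> L} \<in> sets borel"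
    and "{x. lattice_floor x \<in> L} \<in> lmeasurable"
    and "measure lebesgue {x. lattice_floor x \<in> L} = real (card L)"
proof -
  have U: "{x. lattice_floor x \<in> L} = (\<Union>\<omega>\<in>L. {x. lattice_floor x = \<omega>})" by auto
  show "{x. lattice_floor x \<in> L} \<in> sets borel"
    unfolding U using assms by (intro sets.finite_UN lattice_cell) auto
  show "{x. lattice_floor x \<in> L} \<in> lmeasurable"
    unfolding U using assms by (intro fmeasurable.finite_UN lattice_cell) auto
  have "measure lebesgue (\<Union>\<omega>\<in>L. {x. lattice_floor x = \<omega>})
      = (\<Sum>\<omega>\<in>L. measure lebesgue {x. lattice_floor x = \<omega>})"
  proof (rule measure_negligible_finite_Union_image)
    show "pairwise (\<lambda>x y. negligible ({z. lattice_floor z = x} \<inter> {z. lattice_floor z = y})) L"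
      by (auto simp: pairwise_def intro!: negligible_subset[OF negligible_empty])
  qed (use assms lattice_cell in auto)
  also have "\<dots> = (\<Sum>\<omega>\<in>L. 1)"
    using assms(2) by (intro sum.cong lattice_cell(3)) auto
  also have "\<dots> = real (card L)" by simp
  finally show "measure lebesgue {x. lattice_floor x \<in> L} = real (card L)"
    by (simp add: U)
qed

context anisotropic_gauge
begin

lemma finite_sublevel_lattice: "finite (sublevel \<phi> r \<inter> int_lattice)"
  by (intro finite_bounded_lattice bounded_sublevel)

text \<open>Uniformity comes from compactness, as points close to the bounded set \<open>B\<close> stay in a fixed ball.\<close>

lemma gauge_uniformly_continuous:
  assumes "\<eta> > 0"
  obtains \<delta> where "\<delta> > 0"
    "\<And>x y. \<phi> x < 1 \<Longrightarrow> norm (y - x) < \<delta> \<Longrightarrow> \<bar>\<phi> y - \<phi> x\<bar> < \<eta>"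
proof -
  obtain K where K: "\<And>x. \<phi> x < 1 \<Longrightarrow> norm x \<le> K"
    using bounded_sublevel[of 1] by (auto simp: bounded_iff sublevel_def)
  have "uniformly_continuous_on (cball 0 (K + 1)) \<phi>"
    using continuous_on_subset[OF cont] by (intro compact_uniformly_continuous) auto
  then obtain \<delta> where \<delta>: "\<delta> > 0"
    "\<And>x y. x \<in> cball 0 (K + 1) \<Longrightarrow> y \<in> cball 0 (K + 1) \<Longrightarrow> dist y x < \<delta> \<Longrightarrow> dist (\<phi> y) (\<phi> x) < \<eta>"
    using assms unfolding uniformly_continuous_on_def by metis
  show ?thesis
  proof (rule that)
    fix x y assume xy: "\<phi> x < 1" "norm (y - x) < min \<delta> 1"
    have "norm y \<le> norm x + norm (y - x)" by (metis norm_triangle_sub)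
    then show "\<bar>\<phi> y - \<phi> x\<bar> < \<eta>"
      using \<delta>(2)[of x y] xy K[OF xy(1)] by (simp add: dist_norm)
  qed (use \<delta> in auto)
qed

text \<open>After rescaling by \<open>r^(- A)\<close> the unit cells have arbitrarily small diameter, since the dilations
  contract. Moving a point near \<open>B\<close> to the corner of its rescaled cell then changes \<open>\<phi>\<close> by less than
  \<open>\<eta>\<close>, so the union of the rescaled cells whose corners lie in \<open>B\<close> is squeezed between two sublevel sets.\<close>

lemma rescaled_cells_sandwich:
  assumes "\<eta> > 0"
  shows "\<forall>\<^sub>F r in at_top.
    sublevel \<phi> (1 - \<eta>) \<subseteq> flow (- ln r) ` {x. lattice_floor x \<in> sublevel \<phi> r \<inter> int_lattice} \<and>
    flow (- ln r) ` {x. lattice_floor x \<in> sublevel \<phi> r \<inter> int_lattice} \<subseteq> sublevel \<phi> (1 + \<eta>)"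
proof -
  obtain \<delta> where \<delta>: "\<delta> > 0"
    "\<And>x y. \<phi> x < 1 \<Longrightarrow> norm (y - x) < \<delta> \<Longrightarrow> \<bar>\<phi> y - \<phi> x\<bar> < \<eta>"
    using gauge_uniformly_continuous[OF assms] by blast
  define n where "n = real CARD('n)"
  have n: "n > 0" by (simp add: n_def)
  \<comment> \<open>Rounding moves a point by at most \<open>n\<close>; the factor 2 makes the final estimate strict.\<close>
  obtain s\<^sub>0 where s\<^sub>0: "\<And>s x. s \<ge> s\<^sub>0 \<Longrightarrow> norm (flow (- s) x) \<le> (\<delta> / (2 * n)) * norm x"
    using flow_contracts[of "\<delta> / (2 * n)"] \<delta> n by auto
  have close: "norm (flow (- s) (lattice_floor z) - flow (- s) z) < \<delta>" if "s \<ge> s\<^sub>0" for s z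
  proof -
    have "norm (flow (- s) (lattice_floor z - z)) \<le> (\<delta> / (2 * n)) * norm (lattice_floor z - z)"
      by (rule s\<^sub>0[OF that])
    also have "\<dots> \<le> (\<delta> / (2 * n)) * n"
      using \<delta> n norm_lattice_floor_diff[of z] by (intro mult_left_mono) (auto simp: n_def)
    also have "\<dots> < \<delta>" using \<delta> n by simp
    finally show ?thesis by (simp add: linear_simps(2)[OF bounded_linear_flow])
  qed
  show ?thesis
    using eventually_ge_at_top[of "exp s\<^sub>0"]
  proof eventually_elim
    case (elim r)
    have r: "r > 0" using elim exp_gt_zero[of s\<^sub>0] by linarith
    define s where "s = ln r"
    have s: "s \<ge> s\<^sub>0" "exp s = r" using elim r by (auto simp: s_def ln_ge_iff)
    have mem: "lattice_floor z \<in> sublevel \<phi> r \<inter> int_lattice \<longleftrightarrow>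
        \<phi> (flow (- s) (lattice_floor z)) < 1" for z
      using r by (simp add: gauge_flow exp_minus s sublevel_def lattice_floor_in_lattice field_simps)
    show ?case unfolding s_def[symmetric]
    proof (intro conjI subsetI)
      fix y assume y: "y \<in> sublevel \<phi> (1 - \<eta>)"
      define z where "z = flow s y"
      have yz: "y = flow (- s) z" by (simp add: z_def flow_inverse)
      have "\<bar>\<phi> (flow (- s) (lattice_floor z)) - \<phi> y\<bar> < \<eta>"
        using y assms close[OF s(1), of z] by (intro \<delta>(2)) (auto simp: yz sublevel_def)
      then have "\<phi> (flow (- s) (lattice_floor z)) < 1"
        using y by (auto simp: sublevel_def)
      then show "y \<in> flow (- s) ` {x. lattice_floor x \<in> sublevel \<phi> r \<inter> int_lattice}"
        unfolding mem yz by blast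
    next
      fix y assume "y \<in> flow (- s) ` {x. lattice_floor x \<in> sublevel \<phi> r \<inter> int_lattice}"
      then obtain z where z: "y = flow (- s) z" "\<phi> (flow (- s) (lattice_floor z)) < 1"
        unfolding mem by blast
      have "\<bar>\<phi> y - \<phi> (flow (- s) (lattice_floor z))\<bar> < \<eta>"
        using z close[OF s(1), of z] by (intro \<delta>(2)) (auto simp: norm_minus_commute)
      then show "y \<in> sublevel \<phi> (1 + \<eta>)"
        using z by (auto simp: sublevel_def)
    qed
  qed
qed

text \<open>The squeezed union has volume \<open>r^(- \<alpha>)\<close> times the number of lattice points.\<close>

lemma lattice_count_bounds:
  assumes "0 < \<eta>" "\<eta> < 1"
  shows "\<forall>\<^sub>F r in at_top.
    (1 - \<eta>) powr trace A * measure lebesgue (sublevel \<phi> 1)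
      \<le> real (card (sublevel \<phi> r \<inter> int_lattice)) / r powr trace A \<and>
    real (card (sublevel \<phi> r \<inter> int_lattice)) / r powr trace A
      \<le> (1 + \<eta>) powr trace A * measure lebesgue (sublevel \<phi> 1)"
  using rescaled_cells_sandwich[OF assms(1)] eventually_gt_at_top[of 0]
proof eventually_elim
  case (elim r)
  let ?L = "sublevel \<phi> r \<inter> int_lattice"
  let ?U = "flow (- ln r) ` {x. lattice_floor x \<in> ?L}"
  note cells = lattice_cells[OF finite_sublevel_lattice[of r] Int_lower2]
  have U: "?U \<in> lmeasurable" "measure lebesgue ?U = real (card ?L) / r powr trace A"
    using flow_image_measure[OF cells(1,2), of "- ln r"] elim(2)
    by (simp_all only: cells(3)) (simp_all add: powr_def exp_minus divide_inverse mult.commute)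
  have "measure lebesgue (sublevel \<phi> (1 - \<eta>)) \<le> measure lebesgue ?U"
    using elim(1) U(1) lmeasurable_sublevel by (intro measure_mono_fmeasurable) auto
  moreover have "measure lebesgue ?U \<le> measure lebesgue (sublevel \<phi> (1 + \<eta>))"
    using elim(1) U(1) lmeasurable_sublevel by (intro measure_mono_fmeasurable) auto
  ultimately show ?case
    using measure_sublevel[of "1 - \<eta>"] measure_sublevel[of "1 + \<eta>"] assms U(2) by simp
qed

lemma lattice_count_asymptotics:
  "((\<lambda>r. real (card (sublevel \<phi> r \<inter> int_lattice)) / r powr trace A)
    \<longlongrightarrow> measure lebesgue (sublevel \<phi> 1)) at_top"
proof -
  let ?V = "measure lebesgue (sublevel \<phi> 1)"
  let ?N = "\<lambda>r. real (card (sublevel \<phi> r \<inter> int_lattice)) / r powr trace A"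
  have small: "\<forall>\<^sub>F \<eta> in at_right 0. 0 < \<eta> \<and> \<eta> < (1 :: real)"
    unfolding eventually_at_right_field by (auto intro: exI[of _ 1])
  have lim: "((\<lambda>\<eta>. (1 + c * \<eta>) powr trace A * ?V) \<longlongrightarrow> ?V) (at_right 0)" for c
    by (auto intro!: tendsto_eq_intros)
  show ?thesis
  proof (rule order_tendstoI)
    fix a assume "a < ?V"
    from eventually_conj[OF small order_tendstoD(1)[OF lim[of "- 1"] this]]
    obtain \<eta> where \<eta>: "0 < \<eta>" "\<eta> < 1" "a < (1 - \<eta>) powr trace A * ?V"
      using eventually_happens[of _ "at_right (0 :: real)"] by auto
    show "\<forall>\<^sub>F r in at_top. a < ?N r"
      using lattice_count_bounds[OF \<eta>(1,2)] by eventually_elim (use \<eta>(3) in auto)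
  next
    fix a assume "?V < a"
    from eventually_conj[OF small order_tendstoD(2)[OF lim[of 1] this]]
    obtain \<eta> where \<eta>: "0 < \<eta>" "\<eta> < 1" "(1 + \<eta>) powr trace A * ?V < a"
      using eventually_happens[of _ "at_right (0 :: real)"] by auto
    show "\<forall>\<^sub>F r in at_top. ?N r < a"
      using lattice_count_bounds[OF \<eta>(1,2)] by eventually_elim (use \<eta>(3) in auto)
  qed
qed

end

section \<open>Dirichlet series with a known counting function\<close>

lemma has_integral_powr_tail:
  fixes R c \<sigma> :: real
  assumes "R > 0" "\<sigma> > 0"
  shows "((\<lambda>u. if c < u then u powr (- \<sigma> - 1) else 0) has_integral
    (max c R powr - \<sigma>) / \<sigma>) {R..}"
proof (rule has_integral_spike_finite[where S = "{c}"])
  have "((\<lambda>u. u powr (- \<sigma> - 1)) has_integral (max c R powr - \<sigma>) / \<sigma>) {max c R..}"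
    using has_integral_powr_to_inf[of "- \<sigma> - 1" "max c R"] assms by simp
  moreover have "{max c R..} = {c..} \<inter> {R..}" by auto
  ultimately show "((\<lambda>u. if u \<in> {c..} then u powr (- \<sigma> - 1) else 0) has_integral
      (max c R powr - \<sigma>) / \<sigma>) {R..}"
    by (subst has_integral_restrict_Int) simp
qed auto

lemma has_integral_powr_diff_tail:
  fixes R \<alpha> \<sigma> :: real
  assumes "R > 0" "\<alpha> < \<sigma>"
  shows "((\<lambda>u. u powr (\<alpha> - \<sigma> - 1)) has_integral R powr (\<alpha> - \<sigma>) / (\<sigma> - \<alpha>)) {R..}"
proof -
  have "- (R powr (\<alpha> - \<sigma>)) / (\<alpha> - \<sigma>) = R powr (\<alpha> - \<sigma>) / (\<sigma> - \<alpha>)"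
    by (metis minus_diff_eq minus_divide_divide)
  then show ?thesis
    using has_integral_powr_to_inf[of "\<alpha> - \<sigma> - 1" R] assms by simp
qed

text \<open>Partial summation: \<open>max (f x) R powr - \<sigma>\<close> is \<open>\<sigma>\<close> times the integral of \<open>u powr (- \<sigma> - 1)\<close> over
  those \<open>u \<ge> R\<close> that exceed \<open>f x\<close>, and summing over \<open>x\<close> makes the counting function appear under
  the integral. The truncation at \<open>R\<close> confines \<open>u\<close> to the range where the asymptotic count can be used;
  restricting to finite sets \<open>F\<close> avoids exchanging an infinite sum with an integral.\<close>

lemma has_integral_counting_function:
  fixes f :: "'a \<Rightarrow> real"
  assumes "finite F" "R > 0" "\<sigma> > 0"
  shows "((\<lambda>u. real (card {x\<in>F. f x < u}) * u powr (- \<sigma> - 1)) has_integral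
    (\<Sum>x\<in>F. max (f x) R powr - \<sigma>) / \<sigma>) {R..}"
proof -
  have "((\<lambda>u. \<Sum>x\<in>F. if f x < u then u powr (- \<sigma> - 1) else 0) has_integral
    (\<Sum>x\<in>F. (max (f x) R powr - \<sigma>) / \<sigma>)) {R..}"
    using assms by (intro has_integral_sum has_integral_powr_tail)
  moreover have "(\<Sum>x\<in>F. if f x < u then u powr (- \<sigma> - 1) else 0)
      = real (card {x\<in>F. f x < u}) * u powr (- \<sigma> - 1)" for u
    using assms(1) by (simp flip: sum.inter_filter)
  ultimately show ?thesis by (simp add: sum_divide_distrib)
qed

text \<open>The finitely many terms below \<open>R\<close> are kept as they are, and the rest is bounded by inserting the bound on
  the count into the integral.\<close>

lemma sum_powr_upper:
  fixes f :: "'a \<Rightarrow> real"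
  assumes F: "finite F" "F \<subseteq> X" and fin: "\<And>u. finite {x\<in>X. f x < u}"
    and R: "R > 0" and \<alpha>: "0 < \<alpha>" "\<alpha> < \<sigma>"
    and count: "\<And>u. u \<ge> R \<Longrightarrow> real (card {x\<in>X. f x < u}) \<le> w * u powr \<alpha>"
  shows "(\<Sum>x\<in>F. f x powr - \<sigma>)
    \<le> (\<Sum>x | x \<in> X \<and> f x < R. f x powr - \<sigma>) + \<sigma> * w * R powr (\<alpha> - \<sigma>) / (\<sigma> - \<alpha>)"
proof -
  define F' where "F' = {x\<in>F. R \<le> f x}"
  have finite_F': "finite F'" using F by (simp add: F'_def)
  have "(\<Sum>x\<in>F'. max (f x) R powr - \<sigma>) / \<sigma> \<le> w * (R powr (\<alpha> - \<sigma>) / (\<sigma> - \<alpha>))"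
  proof (rule has_integral_le[OF has_integral_counting_function[OF finite_F' R]])
    show "((\<lambda>u. w * u powr (\<alpha> - \<sigma> - 1)) has_integral w * (R powr (\<alpha> - \<sigma>) / (\<sigma> - \<alpha>))) {R..}"
      using \<alpha> R by (intro has_integral_mult_right has_integral_powr_diff_tail) auto
    fix u assume u: "u \<in> {R..}"
    have "real (card {x\<in>F'. f x < u}) \<le> real (card {x\<in>X. f x < u})"
      using F by (auto simp: F'_def intro!: card_mono fin)
    also have "\<dots> \<le> w * u powr \<alpha>" using count u by simp
    finally have "real (card {x\<in>F'. f x < u}) * u powr (- \<sigma> - 1) \<le> w * u powr \<alpha> * u powr (- \<sigma> - 1)"
      by (intro mult_right_mono) auto
    also have "\<dots> = w * u powr (\<alpha> - \<sigma> - 1)"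
      by (simp add: mult.assoc flip: powr_add) (simp add: algebra_simps)
    finally show "real (card {x\<in>F'. f x < u}) * u powr (- \<sigma> - 1) \<le> w * u powr (\<alpha> - \<sigma> - 1)" .
  qed (use \<alpha> in auto)
  then have tail: "(\<Sum>x\<in>F'. f x powr - \<sigma>) \<le> \<sigma> * w * R powr (\<alpha> - \<sigma>) / (\<sigma> - \<alpha>)"
    using \<alpha> by (simp add: F'_def field_simps max_absorb1)
  have "(\<Sum>x\<in>F - F'. f x powr - \<sigma>) \<le> (\<Sum>x | x \<in> X \<and> f x < R. f x powr - \<sigma>)"
    using F by (intro sum_mono2 fin) (auto simp: F'_def)
  moreover have "(\<Sum>x\<in>F. f x powr - \<sigma>) = (\<Sum>x\<in>F - F'. f x powr - \<sigma>) + (\<Sum>x\<in>F'. f x powr - \<sigma>)"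
    using F by (intro sum.subset_diff) (auto simp: F'_def)
  ultimately show ?thesis using tail by simp
qed

text \<open>Truncation at \<open>R\<close> only makes terms smaller. The counting function of the finite set agrees with the full
  one only up to \<open>T\<close>, hence the part of the integral beyond \<open>T\<close> that is subtracted.\<close>

lemma sum_powr_lower:
  fixes f :: "'a \<Rightarrow> real"
  assumes fin: "finite {x\<in>X. f x < T}" and pos: "\<And>x. x \<in> X \<Longrightarrow> f x > 0"
    and R: "0 < R" "R \<le> T" and \<alpha>: "0 < \<alpha>" "\<alpha> < \<sigma>"
    and count: "\<And>u. u \<ge> R \<Longrightarrow> v * u powr \<alpha> \<le> real (card {x\<in>X. f x < u})"
  shows "\<sigma> * v * (R powr (\<alpha> - \<sigma>) - T powr (\<alpha> - \<sigma>)) / (\<sigma> - \<alpha>)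
    \<le> (\<Sum>x | x \<in> X \<and> f x < T. f x powr - \<sigma>)"
proof -
  let ?F = "{x\<in>X. f x < T}"
  have "v * (R powr (\<alpha> - \<sigma>) / (\<sigma> - \<alpha>)) - v * (T powr (\<alpha> - \<sigma>) / (\<sigma> - \<alpha>))
      \<le> (\<Sum>x\<in>?F. max (f x) R powr - \<sigma>) / \<sigma>"
  proof (rule has_integral_le[OF has_integral_diff has_integral_counting_function[OF fin R(1)]])
    show "((\<lambda>u. v * u powr (\<alpha> - \<sigma> - 1)) has_integral v * (R powr (\<alpha> - \<sigma>) / (\<sigma> - \<alpha>))) {R..}"
      using \<alpha> R by (intro has_integral_mult_right has_integral_powr_diff_tail) auto
    have "((\<lambda>u. v * u powr (\<alpha> - \<sigma> - 1)) has_integral v * (T powr (\<alpha> - \<sigma>) / (\<sigma> - \<alpha>))) {T..}"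
      using \<alpha> R by (intro has_integral_mult_right has_integral_powr_diff_tail) auto
    then show "((\<lambda>u. if u \<in> {T..} then v * u powr (\<alpha> - \<sigma> - 1) else 0) has_integral
        v * (T powr (\<alpha> - \<sigma>) / (\<sigma> - \<alpha>))) {R..}"
      using R by (subst has_integral_restrict) auto
    fix u assume u: "u \<in> {R..}"
    show "v * u powr (\<alpha> - \<sigma> - 1) - (if u \<in> {T..} then v * u powr (\<alpha> - \<sigma> - 1) else 0)
        \<le> real (card {x\<in>?F. f x < u}) * u powr (- \<sigma> - 1)"
    proof (cases "T \<le> u")
      case False
      then have "{x\<in>?F. f x < u} = {x\<in>X. f x < u}" by auto
      then have "v * u powr \<alpha> * u powr (- \<sigma> - 1) \<le> real (card {x\<in>?F. f x < u}) * u powr (- \<sigma> - 1)"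
        using count u by (intro mult_right_mono) auto
      moreover have "v * u powr \<alpha> * u powr (- \<sigma> - 1) = v * u powr (\<alpha> - \<sigma> - 1)"
        by (simp add: mult.assoc flip: powr_add) (simp add: algebra_simps)
      ultimately show ?thesis using False by simp
    qed simp
  qed (use \<alpha> in auto)
  also have "\<dots> \<le> (\<Sum>x\<in>?F. f x powr - \<sigma>) / \<sigma>"
    using \<alpha> pos by (intro divide_right_mono sum_mono powr_mono2') auto
  finally have "\<sigma> * (v * (R powr (\<alpha> - \<sigma>) / (\<sigma> - \<alpha>)) - v * (T powr (\<alpha> - \<sigma>) / (\<sigma> - \<alpha>)))
      \<le> (\<Sum>x\<in>?F. f x powr - \<sigma>)"
    using \<alpha> by (simp add: pos_le_divide_eq mult.commute)
  then show ?thesis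
    by (simp add: right_diff_distrib diff_divide_distrib mult.assoc)
qed

locale counting_asymptotics =
  fixes X :: "'a set" and f :: "'a \<Rightarrow> real" and \<alpha> V :: real
  assumes pos: "\<And>x. x \<in> X \<Longrightarrow> f x > 0"
    and fin: "\<And>u. finite {x\<in>X. f x < u}"
    and \<alpha>_pos: "\<alpha> > 0"
    and count: "((\<lambda>u. real (card {x\<in>X. f x < u}) / u powr \<alpha>) \<longlongrightarrow> V) at_top"
begin

lemma count_upper:
  assumes "V < w"
  obtains R where "R > 0" "\<And>u. u \<ge> R \<Longrightarrow> real (card {x\<in>X. f x < u}) \<le> w * u powr \<alpha>"
proof -
  have "\<forall>\<^sub>F u in at_top. real (card {x\<in>X. f x < u}) / u powr \<alpha> < w"
    using order_tendstoD(2)[OF count assms] .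
  then obtain R where R: "\<And>u. u \<ge> R \<Longrightarrow> real (card {x\<in>X. f x < u}) / u powr \<alpha> < w"
    unfolding eventually_at_top_linorder by blast
  show ?thesis
  proof (rule that)
    fix u assume "max R 1 \<le> u"
    then show "real (card {x\<in>X. f x < u}) \<le> w * u powr \<alpha>"
      using R[of u] by (simp add: divide_less_eq)
  qed simp
qed

lemma count_lower:
  assumes "v < V"
  obtains R where "R > 0" "\<And>u. u \<ge> R \<Longrightarrow> v * u powr \<alpha> \<le> real (card {x\<in>X. f x < u})"
proof -
  have "\<forall>\<^sub>F u in at_top. v < real (card {x\<in>X. f x < u}) / u powr \<alpha>"
    using order_tendstoD(1)[OF count assms] .
  then obtain R where R: "\<And>u. u \<ge> R \<Longrightarrow> v < real (card {x\<in>X. f x < u}) / u powr \<alpha>"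
    unfolding eventually_at_top_linorder by blast
  show ?thesis
  proof (rule that)
    fix u assume "max R 1 \<le> u"
    then show "v * u powr \<alpha> \<le> real (card {x\<in>X. f x < u})"
      using R[of u] by (simp add: less_divide_eq)
  qed simp
qed

lemma dirichlet_summable:
  assumes "\<alpha> < \<sigma>"
  shows "(\<lambda>x. f x powr - \<sigma>) summable_on X"
proof -
  obtain R where "R > 0" "\<And>u. u \<ge> R \<Longrightarrow> real (card {x\<in>X. f x < u}) \<le> (V + 1) * u powr \<alpha>"
    using count_upper[of "V + 1"] by auto
  then show ?thesis
    using sum_powr_upper[OF _ _ fin _ \<alpha>_pos assms]
    by (intro nonneg_bdd_above_summable_on bdd_aboveI2) auto
qed

lemma dirichlet_upper:
  assumes "R > 0" "\<And>u. u \<ge> R \<Longrightarrow> real (card {x\<in>X. f x < u}) \<le> w * u powr \<alpha>" and "\<alpha> < \<sigma>"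
  shows "(\<Sum>\<^sub>\<infinity>x\<in>X. f x powr - \<sigma>)
    \<le> (\<Sum>x | x \<in> X \<and> f x < R. f x powr - \<sigma>) + \<sigma> * w * R powr (\<alpha> - \<sigma>) / (\<sigma> - \<alpha>)"
  using assms by (intro infsum_le_finite_sums dirichlet_summable sum_powr_upper fin \<alpha>_pos)

lemma dirichlet_lower:
  assumes R: "R > 0" "\<And>u. u \<ge> R \<Longrightarrow> v * u powr \<alpha> \<le> real (card {x\<in>X. f x < u})" and \<sigma>: "\<alpha> < \<sigma>"
  shows "\<sigma> * v * R powr (\<alpha> - \<sigma>) / (\<sigma> - \<alpha>) \<le> (\<Sum>\<^sub>\<infinity>x\<in>X. f x powr - \<sigma>)"
proof (rule tendsto_upperbound)
  have "((\<lambda>T. T powr (\<alpha> - \<sigma>)) \<longlongrightarrow> 0) at_top"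
    using \<sigma> by (intro tendsto_neg_powr filterlim_ident) auto
  then have "((\<lambda>T. \<sigma> * v * (R powr (\<alpha> - \<sigma>) - T powr (\<alpha> - \<sigma>)) / (\<sigma> - \<alpha>))
      \<longlongrightarrow> \<sigma> * v * (R powr (\<alpha> - \<sigma>) - 0) / (\<sigma> - \<alpha>)) at_top"
    using \<sigma> by (intro tendsto_divide tendsto_mult tendsto_diff tendsto_const) auto
  then show "((\<lambda>T. \<sigma> * v * (R powr (\<alpha> - \<sigma>) - T powr (\<alpha> - \<sigma>)) / (\<sigma> - \<alpha>))
      \<longlongrightarrow> \<sigma> * v * R powr (\<alpha> - \<sigma>) / (\<sigma> - \<alpha>)) at_top"
    by simp
  show "\<forall>\<^sub>F T in at_top. \<sigma> * v * (R powr (\<alpha> - \<sigma>) - T powr (\<alpha> - \<sigma>)) / (\<sigma> - \<alpha>)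
      \<le> (\<Sum>\<^sub>\<infinity>x\<in>X. f x powr - \<sigma>)"
    using eventually_ge_at_top[of R]
  proof eventually_elim
    case (elim T)
    have "\<sigma> * v * (R powr (\<alpha> - \<sigma>) - T powr (\<alpha> - \<sigma>)) / (\<sigma> - \<alpha>)
        \<le> (\<Sum>x | x \<in> X \<and> f x < T. f x powr - \<sigma>)"
      using elim by (intro sum_powr_lower fin pos R \<alpha>_pos \<sigma>)
    also have "\<dots> \<le> (\<Sum>\<^sub>\<infinity>x\<in>X. f x powr - \<sigma>)"
      by (intro finite_sum_le_infsum dirichlet_summable \<sigma> fin) auto
    finally show ?case .
  qed
qed simp

text \<open>The factor \<open>\<sigma> - \<alpha>\<close> removes the finite part of the upper bound in the limit and cancels the pole of
  the tails, leaving \<open>\<alpha> v\<close> and \<open>\<alpha> w\<close> for arbitrary \<open>v < V < w\<close>.\<close>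

lemma dirichlet_residue:
  "((\<lambda>\<sigma>. (\<sigma> - \<alpha>) * (\<Sum>\<^sub>\<infinity>x\<in>X. f x powr - \<sigma>)) \<longlongrightarrow> \<alpha> * V) (at_right \<alpha>)"
proof (rule order_tendstoI)
  have right: "\<forall>\<^sub>F \<sigma> in at_right \<alpha>. \<alpha> < \<sigma>"
    by (simp add: eventually_at_right_less)
  have factor: "((\<lambda>\<sigma>. \<sigma> * y * R powr (\<alpha> - \<sigma>)) \<longlongrightarrow> \<alpha> * y) (at_right \<alpha>)" if "R > 0" for y R :: real
    using that by (auto intro!: tendsto_eq_intros)
  {
    fix a assume "a < \<alpha> * V"
    then have "a / \<alpha> < V" using \<alpha>_pos by (simp add: field_simps)
    then obtain v where v: "a / \<alpha> < v" "v < V" using dense by blast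
    then obtain R where R: "R > 0" "\<And>u. u \<ge> R \<Longrightarrow> v * u powr \<alpha> \<le> real (card {x\<in>X. f x < u})"
      using count_lower by metis
    have "a < \<alpha> * v" using v \<alpha>_pos by (simp add: field_simps)
    from right order_tendstoD(1)[OF factor[OF R(1)] this]
    show "\<forall>\<^sub>F \<sigma> in at_right \<alpha>. a < (\<sigma> - \<alpha>) * (\<Sum>\<^sub>\<infinity>x\<in>X. f x powr - \<sigma>)"
    proof eventually_elim
      case (elim \<sigma>)
      have "\<sigma> * v * R powr (\<alpha> - \<sigma>) \<le> (\<sigma> - \<alpha>) * (\<Sum>\<^sub>\<infinity>x\<in>X. f x powr - \<sigma>)"
        using dirichlet_lower[OF R elim(1)] elim(1) by (simp add: pos_divide_le_eq mult.commute)
      then show ?case using elim by simp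
    qed
  next
    fix a assume "\<alpha> * V < a"
    then have "V < a / \<alpha>" using \<alpha>_pos by (simp add: field_simps)
    then obtain w where w: "V < w" "w < a / \<alpha>" using dense by blast
    then obtain R where R: "R > 0" "\<And>u. u \<ge> R \<Longrightarrow> real (card {x\<in>X. f x < u}) \<le> w * u powr \<alpha>"
      using count_upper by metis
    let ?H = "\<lambda>\<sigma>. \<Sum>x | x \<in> X \<and> f x < R. f x powr - \<sigma>"
    have "((\<lambda>\<sigma>. (\<sigma> - \<alpha>) * ?H \<sigma> + \<sigma> * w * R powr (\<alpha> - \<sigma>))
        \<longlongrightarrow> (\<alpha> - \<alpha>) * ?H \<alpha> + \<alpha> * w) (at_right \<alpha>)"
      by (intro tendsto_add factor R tendsto_mult tendsto_sum tendsto_powr tendsto_diff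
          tendsto_minus tendsto_const tendsto_ident_at) (use pos in force)
    moreover have "(\<alpha> - \<alpha>) * ?H \<alpha> + \<alpha> * w < a" using w \<alpha>_pos by (simp add: field_simps)
    ultimately have "\<forall>\<^sub>F \<sigma> in at_right \<alpha>. (\<sigma> - \<alpha>) * ?H \<sigma> + \<sigma> * w * R powr (\<alpha> - \<sigma>) < a"
      by (rule order_tendstoD(2))
    with right show "\<forall>\<^sub>F \<sigma> in at_right \<alpha>. (\<sigma> - \<alpha>) * (\<Sum>\<^sub>\<infinity>x\<in>X. f x powr - \<sigma>) < a"
    proof eventually_elim
      case (elim \<sigma>)
      have "(\<sigma> - \<alpha>) * (\<Sum>\<^sub>\<infinity>x\<in>X. f x powr - \<sigma>)
          \<le> (\<sigma> - \<alpha>) * (?H \<sigma> + \<sigma> * w * R powr (\<alpha> - \<sigma>) / (\<sigma> - \<alpha>))"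
        using elim(1) by (intro mult_left_mono dirichlet_upper R) auto
      also have "\<dots> = (\<sigma> - \<alpha>) * ?H \<sigma> + \<sigma> * w * R powr (\<alpha> - \<sigma>)"
        using elim(1) by (simp add: distrib_left)
      finally show ?case using elim by simp
    qed
  }
qed

end

section \<open>The lattice zeta function\<close>

theorem theorem1p2:
  fixes A :: "real^'n^'n" and \<phi> :: "real^'n \<Rightarrow> real" and \<alpha> :: real
  assumes "A \<in> M_plus" and "\<alpha> = trace A"
    and "continuous_on UNIV \<phi>" and "positive_homogeneous_wrt A \<phi>"
  shows "(\<forall>s. Re s > \<alpha> \<longrightarrow> zeta_term \<phi> s summable_on (int_lattice - {0}))
    \<and> (sublevel \<phi> 1 \<in> lmeasurable)
    \<and> (((\<lambda>\<sigma>::real. complex_of_real (\<sigma> - \<alpha>) * lattice_zeta \<phi> (complex_of_real \<sigma>))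
           \<longlongrightarrow> complex_of_real (\<alpha> * measure lebesgue (sublevel \<phi> 1))) (at_right \<alpha>))
    \<and> (\<forall>r>0. finite (sublevel \<phi> r \<inter> int_lattice))
    \<and> (((\<lambda>r::real. real (card (sublevel \<phi> r \<inter> int_lattice)) / r powr \<alpha>)
           \<longlongrightarrow> measure lebesgue (sublevel \<phi> 1)) at_top)"
proof -
  interpret anisotropic_gauge A \<phi>
    by unfold_locales (fact assms)+
  let ?V = "measure lebesgue (sublevel \<phi> 1)"
  let ?X = "int_lattice - {0} :: (real^'n) set"
  interpret counting_asymptotics ?X \<phi> \<alpha> ?V
  proof
    show fin: "finite {x \<in> ?X. \<phi> x < u}" for u
      by (rule finite_subset[OF _ finite_sublevel_lattice[of u]]) (auto simp: sublevel_def)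
    show "\<alpha> > 0" using trace_pos assms(2) by simp
    \<comment> \<open>Leaving out the origin lowers the count by one, which is negligible against \<open>u powr \<alpha>\<close>.\<close>
    have "((\<lambda>u. u powr - \<alpha>) \<longlongrightarrow> 0) at_top"
      using \<open>\<alpha> > 0\<close> by (intro tendsto_neg_powr filterlim_ident) auto
    with lattice_count_asymptotics
    have lim: "((\<lambda>u. real (card (sublevel \<phi> u \<inter> int_lattice)) / u powr \<alpha> - u powr - \<alpha>)
        \<longlongrightarrow> ?V - 0) at_top"
      unfolding assms(2) by (rule tendsto_diff)
    have eq: "\<forall>\<^sub>F u in at_top. real (card (sublevel \<phi> u \<inter> int_lattice)) / u powr \<alpha> - u powr - \<alpha>
        = real (card {x \<in> ?X. \<phi> x < u}) / u powr \<alpha>"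
      using eventually_gt_at_top[of 0]
    proof eventually_elim
      case (elim u)
      have "sublevel \<phi> u \<inter> int_lattice = insert 0 {x \<in> ?X. \<phi> x < u}"
        using elim by (auto simp: sublevel_def gauge_zero int_lattice_def)
      then have "card (sublevel \<phi> u \<inter> int_lattice) = Suc (card {x \<in> ?X. \<phi> x < u})"
        using fin by simp
      then show ?case
        by (simp add: powr_minus_divide add_divide_distrib)
    qed
    show "((\<lambda>u. real (card {x \<in> ?X. \<phi> x < u}) / u powr \<alpha>) \<longlongrightarrow> ?V) at_top"
      using Lim_transform_eventually[OF lim eq] by simp
  qed (use gauge_pos in auto)
  have "zeta_term \<phi> s summable_on ?X" if "Re s > \<alpha>" for s
  proof (rule abs_summable_summable)
    have "norm (zeta_term \<phi> s x) = \<phi> x powr - Re s" for x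
      using gauge_nonneg[of x] by (simp add: zeta_term_def norm_powr_real_powr)
    then show "(\<lambda>x. norm (zeta_term \<phi> s x)) summable_on ?X"
      using dirichlet_summable[OF that] by simp
  qed
  moreover have "((\<lambda>\<sigma>. complex_of_real (\<sigma> - \<alpha>) * lattice_zeta \<phi> (complex_of_real \<sigma>))
      \<longlongrightarrow> complex_of_real (\<alpha> * ?V)) (at_right \<alpha>)"
  proof (rule Lim_transform_eventually[OF tendsto_of_real[OF dirichlet_residue]])
    show "\<forall>\<^sub>F \<sigma> in at_right \<alpha>. complex_of_real ((\<sigma> - \<alpha>) * (\<Sum>\<^sub>\<infinity>x\<in>?X. \<phi> x powr - \<sigma>))
        = complex_of_real (\<sigma> - \<alpha>) * lattice_zeta \<phi> (complex_of_real \<sigma>)"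
      using eventually_at_right_less
    proof eventually_elim
      case (elim \<sigma>)
      have "zeta_term \<phi> (complex_of_real \<sigma>) = (\<lambda>x. complex_of_real (\<phi> x powr - \<sigma>))"
        using gauge_nonneg by (simp add: zeta_term_def fun_eq_iff flip: powr_of_real)
      then have "lattice_zeta \<phi> (complex_of_real \<sigma>) = complex_of_real (\<Sum>\<^sub>\<infinity>x\<in>?X. \<phi> x powr - \<sigma>)"
        unfolding lattice_zeta_def
        by (simp only:) (intro infsumI has_sum_of_real has_sum_infsum dirichlet_summable elim)
      then show ?case by simp
    qed
  qed
  ultimately show ?thesis
    using lattice_count_asymptotics lmeasurable_sublevel finite_sublevel_lattice
    by (simp add: assms(2))
qed

end
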